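(* Let $f : B(\Omega,\mathcal{A})\rightarrow \mathbb{R}$ be a monotone pricing rule. Then the following are equivalent: (i) $f$ satisfies the Put-Call Parity (PCP); (ii) $f$ is a Choquet pricing rule.
   Context: $\Omega$ is a set (finite or infinite) endowed with a $\sigma$-algebra $\mathcal{A}$, and $B(\Omega,\mathcal{A})$ is the set of all bounded, $\mathcal{A}$-measurable functions $x:\Omega\to\mathbb{R}$, with pointwise operations and pointwise order. For $A\in\mathcal{A}$, $\boldsymbol{1}_A$ is the indicator function of $A$. For $x\in B(\Omega,\mathcal{A})$, $x^+ := x\vee 0$ (pointwise maximum). A pricing rule is a function $f:B(\Omega,\mathcal{A})\to\mathbb{R}$ that is not identically zero. It is monotone if $x\ge x'$ implies $f(x)\ge f(x')$. For $x\in B(\Omega,\mathcal{A})$ and $k\ge 0$, let $c_{x,k}=(x-k\boldsymbol{1}_\Omega)^+$ and $p_{x,k}=(k\boldsymbol{1}_\Omega-x)^+$. PCP: $f(x)= f(c_{x,k})+f(-p_{x,k})+f(k\boldsymbol{1}_\Omega)$ for all $x\in B(\Omega,\mathcal{A})$ and all $k\ge 0$. A capacity on $(\Omega,\mathcal{A})$ is a set function $v:\mathcal{A}\to\mathbb{R}$ with $v(\emptyset)=0$ and $v(A)\le v(B)$ whenever $A\subseteq B$, $A,B\in\mathcal{A}$. The Choquet integral of $x\in B(\Omega,\mathcal{A})$ with respect to $v$ is $$\int^C x\,dv:=\int_{-\infty}^0\big(v(\{x\geq t\})-v(\Omega)\big)\,dt + \int_0^{+\infty}v(\{x\geq t\})\,dt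 .$$ $f$ is a Choquet pricing rule if there is a capacity $v$ with $f(x)=\int^C x\,dv$ for all $x\in B(\Omega,\mathcal{A})$. *)

theory Defs
  imports "HOL-Analysis.Analysis"
begin

text \<open>
  Functions on the carrier \<open>\<Omega>\<close> are represented by extensional functions (\<open>undefined\<close> off
  \<open>\<Omega>\<close>), so that distinct elements of \<open>bdd_meas \<Omega> \<A>\<close> are distinct functions on \<open>\<Omega>\<close> and
  \<open>x \<le> y\<close> in \<open>bdd_meas \<Omega> \<A>\<close> is the pointwise order on \<open>\<Omega>\<close>. If \<open>\<A>\<close> is a
  \<open>\<sigma>\<close>-algebra on \<open>\<Omega>\<close>, the measurable sets of \<open>sigma \<Omega> \<A>\<close> are exactly those in \<open>\<A>\<close>.
\<close>

definition bdd_meas :: "'a set \<Rightarrow> 'a set set \<Rightarrow> ('a \<Rightarrow> real) set" where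
  "bdd_meas \<Omega> \<A> =
     {x \<in> extensional \<Omega>. x \<in> borel_measurable (sigma \<Omega> \<A>) \<and> bounded (x ` \<Omega>)}"

definition pricing_rule :: "'a set \<Rightarrow> 'a set set \<Rightarrow> (('a \<Rightarrow> real) \<Rightarrow> real) \<Rightarrow> bool" where
  "pricing_rule \<Omega> \<A> f \<longleftrightarrow> (\<exists>x \<in> bdd_meas \<Omega> \<A>. f x \<noteq> 0)"

definition monotone_rule :: "'a set \<Rightarrow> 'a set set \<Rightarrow> (('a \<Rightarrow> real) \<Rightarrow> real) \<Rightarrow> bool" where
  "monotone_rule \<Omega> \<A> f \<longleftrightarrow>
     (\<forall>x \<in> bdd_meas \<Omega> \<A>. \<forall>x' \<in> bdd_meas \<Omega> \<A>. (\<forall>\<omega>\<in>\<Omega>. x \<omega> \<ge> x' \<omega>) \<longrightarrow> f x \<ge> f x')"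

definition call_payoff :: "'a set \<Rightarrow> ('a \<Rightarrow> real) \<Rightarrow> real \<Rightarrow> 'a \<Rightarrow> real" where
  "call_payoff \<Omega> x k = (\<lambda>\<omega>\<in>\<Omega>. max (x \<omega> - k) 0)"

definition put_payoff :: "'a set \<Rightarrow> ('a \<Rightarrow> real) \<Rightarrow> real \<Rightarrow> 'a \<Rightarrow> real" where
  "put_payoff \<Omega> x k = (\<lambda>\<omega>\<in>\<Omega>. max (k - x \<omega>) 0)"

definition put_call_parity :: "'a set \<Rightarrow> 'a set set \<Rightarrow> (('a \<Rightarrow> real) \<Rightarrow> real) \<Rightarrow> bool" where
  "put_call_parity \<Omega> \<A> f \<longleftrightarrow>
     (\<forall>x \<in> bdd_meas \<Omega> \<A>. \<forall>k \<ge> 0.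
        f x = f (call_payoff \<Omega> x k) + f (\<lambda>\<omega>\<in>\<Omega>. - put_payoff \<Omega> x k \<omega>) + f (\<lambda>\<omega>\<in>\<Omega>. k))"

definition capacity :: "'a set set \<Rightarrow> ('a set \<Rightarrow> real) \<Rightarrow> bool" where
  "capacity \<A> v \<longleftrightarrow> v {} = 0 \<and> (\<forall>A\<in>\<A>. \<forall>B\<in>\<A>. A \<subseteq> B \<longrightarrow> v A \<le> v B)"

text \<open>
  For a capacity \<open>v\<close> and \<open>x \<in> bdd_meas \<Omega> \<A>\<close> both integrands are monotone in \<open>t\<close> and vanish
  outside a bounded interval; hence they are Lebesgue integrable, and the integrals agree
  with the (improper) Riemann ones.
\<close>

definition choquet_integral :: "'a set \<Rightarrow> ('a set \<Rightarrow> real) \<Rightarrow> ('a \<Rightarrow> real) \<Rightarrow> real" where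
  "choquet_integral \<Omega> v x =
     (LBINT t=-\<infinity>..0. v {\<omega>\<in>\<Omega>. x \<omega> \<ge> t} - v \<Omega>) + (LBINT t=0..\<infinity>. v {\<omega>\<in>\<Omega>. x \<omega> \<ge> t})"

definition choquet_pricing_rule :: "'a set \<Rightarrow> 'a set set \<Rightarrow> (('a \<Rightarrow> real) \<Rightarrow> real) \<Rightarrow> bool" where
  "choquet_pricing_rule \<Omega> \<A> f \<longleftrightarrow>
     (\<exists>v. capacity \<A> v \<and> (\<forall>x \<in> bdd_meas \<Omega> \<A>. f x = choquet_integral \<Omega> v x))"

end

theory Submission
  imports Defs
begin

text \<open>
  Parity is equivalent to splitting a claim at a level \<open>k\<close> into its cap \<open>min x k\<close> and its excess
  \<open>max (x - k) 0\<close>, together with invariance under adding constants. Hence for \<open>x \<ge> 0\<close> the slice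
  of \<open>x\<close> between two levels \<open>s \<le> t\<close> is priced at \<open>F t - F s\<close> with \<open>F t = f (min x t)\<close>.
  The slice lies between \<open>(t - s) 1\<^bsub>{x \<ge> t}\<^esub>\<close> and \<open>(t - s) 1\<^bsub>{x \<ge> s}\<^esub>\<close>, so \<open>F\<close> is the integral of
  \<open>t \<mapsto> v {x \<ge> t}\<close>, where \<open>v A = f 1\<^bsub>A\<^esub>\<close>.
  Conversely, up to a shift by \<open>k\<close>, the call and the put carry the parts of the Choquet integral
  above and below the level \<open>k\<close>.
\<close>

section \<open>Real functions\<close>

text \<open>The Archimedean property. It stands in for the passage to the limit in \<open>n\<close>,
  both for partitions into \<open>n\<close> parts and for approximation by fractions
  \<open>m / n\<close>.\<close>

lemma zero_if_le_inverse_nat: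
  fixes d c :: real
  assumes "\<And>n. n > 0 \<Longrightarrow> real n * \<bar>d\<bar> \<le> c"
  shows "d = 0"
proof (rule ccontr)
  assume "d \<noteq> 0"
  then obtain n where n: "real n * \<bar>d\<bar> > c"
    using reals_Archimedean3[of "\<bar>d\<bar>"] by auto
  \<comment> \<open>The \<open>n\<close> obtained may be 0 when \<open>c\<close> is negative, so the
    bound is applied at \<open>Suc n\<close>.\<close>
  have "real (Suc n) * \<bar>d\<bar> \<le> c" by (rule assms) simp
  moreover have "real (Suc n) * \<bar>d\<bar> \<ge> real n * \<bar>d\<bar>" by (simp add: algebra_simps)
  ultimately show False using n by linarith
qed

lemma antimono_on_integrable:
  fixes g :: "real \<Rightarrow> real"
  assumes "antimono_on {a..b} g"
  shows "g integrable_on {a..b}"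
proof -
  have "mono_on {a..b} (\<lambda>t. - g t)"
    using assms by (auto simp: monotone_on_def)
  then have "(\<lambda>t. - g t) integrable_on {a..b}" by (rule integrable_on_mono_on)
  from integrable_neg[OF this] show ?thesis by simp
qed

text \<open>A monotone function is Borel, and on a compact interval its end values bound it. This
  supplies the Lebesgue integrability required for passing from \<open>LBINT\<close> to the gauge
  integral \<open>integral\<close>.\<close>

lemma antimono_set_integrable:
  fixes g :: "real \<Rightarrow> real"
  assumes "antimono g"
  shows "set_integrable lborel {a..b} g"
proof -
  have "mono (\<lambda>t. - g t)" using assms by (auto simp: monotone_on_def)
  then have "(\<lambda>t. - (- g t)) \<in> borel_measurable borel"
    by (intro borel_measurable_uminus borel_measurable_mono)
  moreover have "norm (g t) \<le> \<bar>g a\<bar> + \<bar>g b\<bar>" if "t \<in> {a..b}" for t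
  proof -
    have "g b \<le> g t" "g t \<le> g a" using assms that by (auto simp: monotone_on_def)
    then show ?thesis by auto
  qed
  ultimately show ?thesis
    unfolding set_integrable_def
    by (intro integrableI_bounded_set_indicator[where B = "\<bar>g a\<bar> + \<bar>g b\<bar>"])
       (auto simp: emeasure_lborel_Icc_eq)
qed

text \<open>Telescoping over a partition into \<open>n\<close> equal parts gives \<open>\<bar>D b - D a\<bar> = O(1/n)\<close>.\<close>

lemma eq_if_increment_dominated:
  fixes D g :: "real \<Rightarrow> real"
  assumes "a \<le> b"
    and inc: "\<And>s t. a \<le> s \<Longrightarrow> s \<le> t \<Longrightarrow> t \<le> b \<Longrightarrow> \<bar>D t - D s\<bar> \<le> (t - s) * (g s - g t)"
  shows "D b = D a"
proof -
  have "real n * \<bar>D b - D a\<bar> \<le> (b - a) * (g a - g b)" if "n > 0" for n :: nat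
  proof -
    define p where "p i = a + real i * ((b - a) / real n)" for i
    have p0: "p 0 = a" and pn: "p n = b" using that by (auto simp: p_def)
    have step: "p (Suc i) - p i = (b - a) / real n" for i
      by (simp add: p_def distrib_right add_divide_distrib)
    have mono_p: "p i \<le> p j" if "i \<le> j" for i j
      using that \<open>a \<le> b\<close> unfolding p_def
      by (intro add_left_mono mult_right_mono) auto
    have "D b - D a = (\<Sum>i<n. D (p (Suc i)) - D (p i))"
      by (subst sum_lessThan_telescope) (simp add: p0 pn)
    then have "\<bar>D b - D a\<bar> \<le> (\<Sum>i<n. \<bar>D (p (Suc i)) - D (p i)\<bar>)"
      by simp
    also have "\<dots> \<le> (\<Sum>i<n. ((b - a) / real n) * (g (p i) - g (p (Suc i))))"
    proof (rule sum_mono)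
      fix i assume "i \<in> {..<n}"
      then have "a \<le> p i" "p i \<le> p (Suc i)" "p (Suc i) \<le> b"
        using mono_p[of 0 i] mono_p[of i "Suc i"] mono_p[of "Suc i" n] by (auto simp: p0 pn)
      then show "\<bar>D (p (Suc i)) - D (p i)\<bar> \<le> ((b - a) / real n) * (g (p i) - g (p (Suc i)))"
        using inc[of "p i" "p (Suc i)"] by (simp add: step)
    qed
    also have "\<dots> = ((b - a) / real n) * (\<Sum>i<n. g (p i) - g (p (Suc i)))"
      by (simp add: sum_distrib_left)
    also have "\<dots> = ((b - a) / real n) * (g a - g b)"
      by (subst sum_lessThan_telescope') (simp add: p0 pn)
    finally show ?thesis using that by (simp add: field_simps)
  qed
  then have "D b - D a = 0" by (rule zero_if_le_inverse_nat)
  then show ?thesis by simp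
qed

text \<open>The increments of the indefinite integral \<open>H\<close> of \<open>g\<close> obey the
  same bounds as those of \<open>F\<close>. Hence the increments of \<open>F - H\<close> are at most
  \<open>(t - s) * (g s - g t)\<close> in absolute value, and the previous lemma applies even if
  \<open>g\<close> jumps.\<close>

lemma integral_eq_if_sandwich:
  fixes F g :: "real \<Rightarrow> real"
  assumes "a \<le> b"
    and lower: "\<And>s t. a \<le> s \<Longrightarrow> s \<le> t \<Longrightarrow> t \<le> b \<Longrightarrow> (t - s) * g t \<le> F t - F s"
    and upper: "\<And>s t. a \<le> s \<Longrightarrow> s \<le> t \<Longrightarrow> t \<le> b \<Longrightarrow> F t - F s \<le> (t - s) * g s"
  shows "integral {a..b} g = F b - F a"
proof -
  \<comment> \<open>The two bounds on one interval, divided by \<open>t - s\<close>, make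
    \<open>g\<close> decreasing and therefore integrable.\<close>
  have anti: "g t \<le> g s" if "a \<le> s" "s \<le> t" "t \<le> b" for s t
  proof (cases "s = t")
    case False
    have "(t - s) * g t \<le> (t - s) * g s"
      using lower[OF that] upper[OF that] by linarith
    then show ?thesis using False that by simp
  qed simp
  have int: "g integrable_on {s..t}" if "a \<le> s" "t \<le> b" for s t
    using that by (intro antimono_on_integrable) (auto simp: monotone_on_def intro: anti)
  define H where "H t = integral {a..t} g" for t
  have "(F b - H b) = (F a - H a)"
  proof (rule eq_if_increment_dominated[OF \<open>a \<le> b\<close>])
    fix s t assume st: "a \<le> s" "s \<le> t" "t \<le> b"
    have "H t - H s = integral {s..t} g"
      using Henstock_Kurzweil_Integration.integral_combine[OF st(1,2), of g] int[of a t] st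
      by (simp add: H_def)
    moreover have "integral {s..t} g \<le> integral {s..t} (\<lambda>_. g s)"
      using st by (intro integral_le int) (auto intro: anti)
    moreover have "integral {s..t} (\<lambda>_. g t) \<le> integral {s..t} g"
      using st by (intro integral_le int) (auto intro: anti)
    ultimately have "H t - H s \<le> (t - s) * g s" "(t - s) * g t \<le> H t - H s"
      using st by auto
    then show "\<bar>(F t - H t) - (F s - H s)\<bar> \<le> (t - s) * (g s - g t)"
      using lower[OF st] upper[OF st] by (auto simp: algebra_simps)
  qed
  then show ?thesis by (simp add: H_def)
qed

text \<open>Cauchy's functional equation on the half-line: additivity gives homogeneity for natural
  factors, and monotonicity extends it to real ones.\<close>

lemma mono_additive_linear:
  fixes h :: "real \<Rightarrow> real"
  assumes add: "\<And>a b. a \<ge> 0 \<Longrightarrow> b \<ge> 0 \<Longrightarrow> h (a + b) = h a + h b"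
    and mono: "\<And>a b. 0 \<le> a \<Longrightarrow> a \<le> b \<Longrightarrow> h a \<le> h b"
    and "c \<ge> 0"
  shows "h c = c * h 1"
proof -
  have h0: "h 0 = 0" using add[of 0 0] by simp
  have mult: "h (real n * a) = real n * h a" if "a \<ge> 0" for a n
    using that by (induction n) (auto simp: h0 algebra_simps add)
  have h1: "h 1 \<ge> 0" using mono[of 0 1] h0 by simp
  have "real n * \<bar>h c - c * h 1\<bar> \<le> h 1" for n
  proof -
    \<comment> \<open>Both \<open>n * h c = h (n * c)\<close> and \<open>n * c * h 1\<close> lie
      between \<open>m * h 1\<close> and \<open>(m + 1) * h 1\<close>, so they differ by at most
      \<open>h 1\<close>, uniformly in \<open>n\<close>.\<close>
    define m where "m = nat \<lfloor>real n * c\<rfloor>"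
    have "real m = of_int \<lfloor>real n * c\<rfloor>"
      using \<open>c \<ge> 0\<close> by (simp add: m_def)
    then have m: "real m \<le> real n * c" "real n * c \<le> real (Suc m)"
      by linarith+
    have "real m * h 1 \<le> real n * h c"
      using mono[OF _ m(1)] mult[of 1 m] mult[OF \<open>c \<ge> 0\<close>, of n] by simp
    moreover have "real n * h c \<le> real (Suc m) * h 1"
      using mono[OF _ m(2)] mult[of 1 "Suc m"] mult[OF \<open>c \<ge> 0\<close>, of n] \<open>c \<ge> 0\<close> by simp
    moreover have "real m * h 1 \<le> (real n * c) * h 1" "(real n * c) * h 1 \<le> real (Suc m) * h 1"
      using m h1 by (auto intro: mult_right_mono simp del: of_nat_Suc)
    ultimately have "\<bar>real n * (h c - c * h 1)\<bar> \<le> h 1"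
      by (simp add: algebra_simps abs_le_iff)
    then show ?thesis by (simp add: abs_mult)
  qed
  then have "h c - c * h 1 = 0" by (rule zero_if_le_inverse_nat)
  then show ?thesis by simp
qed

section \<open>Bounded measurable functions\<close>

context
  fixes \<Omega> :: "'a set" and \<A> :: "'a set set"
  assumes sigma: "sigma_algebra \<Omega> \<A>"
begin

lemma sets_sigma_eq: "sets (sigma \<Omega> \<A>) = \<A>"
  by (rule sigma_algebra.sets_measure_of_eq[OF sigma])

lemma space_sigma_eq: "space (sigma \<Omega> \<A>) = \<Omega>"
  by (rule sigma_algebra.space_measure_of_eq[OF sigma])

lemma carrier_in_sigma_algebra: "\<Omega> \<in> \<A>"
  using sets.top[of "sigma \<Omega> \<A>"] unfolding sets_sigma_eq space_sigma_eq .

lemma bdd_meas_superlevel: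
  assumes "x \<in> bdd_meas \<Omega> \<A>"
  shows "{\<omega>\<in>\<Omega>. t \<le> x \<omega>} \<in> \<A>"
proof -
  have [measurable]: "x \<in> borel_measurable (sigma \<Omega> \<A>)"
    using assms by (simp add: bdd_meas_def)
  have "{\<omega>\<in>space (sigma \<Omega> \<A>). t \<le> x \<omega>} \<in> sets (sigma \<Omega> \<A>)" by measurable
  then show ?thesis by (simp add: sets_sigma_eq space_sigma_eq)
qed

lemma bdd_meas_compose:
  assumes "x \<in> bdd_meas \<Omega> \<A>" and "continuous_on UNIV \<phi>"
  shows "(\<lambda>\<omega>\<in>\<Omega>. \<phi> (x \<omega>)) \<in> bdd_meas \<Omega> \<A>"
proof -
  have x: "x \<in> borel_measurable (sigma \<Omega> \<A>)" "bounded (x ` \<Omega>)"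
    using assms(1) by (simp_all add: bdd_meas_def)
  have "(\<lambda>\<omega>. \<phi> (x \<omega>)) \<in> borel_measurable (sigma \<Omega> \<A>)"
    using borel_measurable_continuous_onI[OF assms(2)] x(1) by (rule measurable_compose_rev)
  then have "(\<lambda>\<omega>\<in>\<Omega>. \<phi> (x \<omega>)) \<in> borel_measurable (sigma \<Omega> \<A>)"
    by (subst measurable_cong[where g = "\<lambda>\<omega>. \<phi> (x \<omega>)"]) (simp_all add: space_sigma_eq)
  \<comment> \<open>\<open>\<phi>\<close> may be unbounded on the line, but the closure of the
    bounded range of \<open>x\<close> is compact.\<close>
  moreover have "bounded (\<phi> ` closure (x ` \<Omega>))"
    using x(2) assms(2)
    by (intro compact_imp_bounded compact_continuous_image)
       (auto intro: continuous_on_subset)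
  then have "bounded ((\<lambda>\<omega>. \<phi> (x \<omega>)) ` \<Omega>)"
    by (rule bounded_subset) (use closure_subset[of "x ` \<Omega>"] in auto)
  ultimately show ?thesis by (simp add: bdd_meas_def image_restrict_eq)
qed

lemma bdd_meas_indicator:
  assumes "A \<in> \<A>"
  shows "(\<lambda>\<omega>\<in>\<Omega>. c * indicat_real A \<omega>) \<in> bdd_meas \<Omega> \<A>"
proof -
  have [measurable]: "A \<in> sets (sigma \<Omega> \<A>)" using assms by (simp add: sets_sigma_eq)
  have "(\<lambda>\<omega>. c * indicat_real A \<omega>) \<in> borel_measurable (sigma \<Omega> \<A>)" by measurable
  then have "(\<lambda>\<omega>\<in>\<Omega>. c * indicat_real A \<omega>) \<in> borel_measurable (sigma \<Omega> \<A>)"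
    by (subst measurable_cong[where g = "\<lambda>\<omega>. c * indicat_real A \<omega>"]) (simp_all add: space_sigma_eq)
  moreover have "bounded ((\<lambda>\<omega>. c * indicat_real A \<omega>) ` \<Omega>)"
    by (rule finite_imp_bounded, rule finite_subset[of _ "{0, c}"]) (auto simp: indicator_def)
  ultimately show ?thesis by (simp add: bdd_meas_def image_restrict_eq)
qed

lemma bdd_meas_const: "(\<lambda>\<omega>\<in>\<Omega>. c) \<in> bdd_meas \<Omega> \<A>"
  \<comment> \<open>The indicator of \<Omega> merely supplies a member that can be composed with a
    constant map.\<close>
  using bdd_meas_compose[OF bdd_meas_indicator[OF carrier_in_sigma_algebra], of "\<lambda>_. c"]
  by (simp cong: restrict_cong)

lemma bdd_meas_bounds:
  assumes "x \<in> bdd_meas \<Omega> \<A>"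
  shows "\<exists>B\<ge>0. \<forall>\<omega>\<in>\<Omega>. - B \<le> x \<omega> \<and> x \<omega> \<le> B"
proof -
  obtain B where B: "B > 0" "\<forall>y \<in> x ` \<Omega>. norm y \<le> B"
    using assms unfolding bdd_meas_def bounded_pos by auto
  then show ?thesis by (intro exI[of _ B]) (auto simp: abs_le_iff)
qed

section \<open>The Choquet integral over a finite range\<close>

lemma capacity_superlevel_antimono:
  assumes "capacity \<A> v" and "x \<in> bdd_meas \<Omega> \<A>"
  shows "antimono (\<lambda>t. v {\<omega>\<in>\<Omega>. t \<le> x \<omega>})"
proof (rule antimonoI)
  fix s t :: real assume "s \<le> t"
  then have "{\<omega>\<in>\<Omega>. t \<le> x \<omega>} \<subseteq> {\<omega>\<in>\<Omega>. s \<le> x \<omega>}" by auto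
  then show "v {\<omega>\<in>\<Omega>. t \<le> x \<omega>} \<le> v {\<omega>\<in>\<Omega>. s \<le> x \<omega>}"
    using assms bdd_meas_superlevel by (auto simp: capacity_def)
qed

text \<open>At levels up to \<open>a\<close> the superlevel set is \<Omega>, above \<open>b\<close>
  it is empty, so both improper integrals reduce to bounded intervals; subtracting
  \<open>v \<Omega>\<close> over \<open>[a, 0]\<close> leaves \<open>a * v \<Omega>\<close>. The
  bounds stay free so that each payoff can be given its own interval.\<close>

lemma choquet_integral_eq:
  assumes v: "capacity \<A> v" and x: "x \<in> bdd_meas \<Omega> \<A>"
    and "a \<le> 0" "0 \<le> b"
    and lo: "\<And>\<omega>. \<omega> \<in> \<Omega> \<Longrightarrow> a \<le> x \<omega>" and hi: "\<And>\<omega>. \<omega> \<in> \<Omega> \<Longrightarrow> x \<omega> \<le> b"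
  shows "choquet_integral \<Omega> v x = integral {a..b} (\<lambda>t. v {\<omega>\<in>\<Omega>. t \<le> x \<omega>}) + a * v \<Omega>"
proof -
  define g where "g t = v {\<omega>\<in>\<Omega>. t \<le> x \<omega>}" for t
  have anti: "antimono g" unfolding g_def by (rule capacity_superlevel_antimono[OF v x])
  then have anti': "antimono (\<lambda>t. g t - v \<Omega>)" by (auto simp: monotone_on_def)
  have int: "g integrable_on {s..t}" for s t
    using anti by (intro antimono_on_integrable) (auto simp: monotone_on_def)
  have below: "g t = v \<Omega>" if "t \<le> a" for t
  proof -
    have "{\<omega>\<in>\<Omega>. t \<le> x \<omega>} = \<Omega>" using lo that by force
    then show ?thesis by (simp add: g_def)
  qed
  have above: "g t = 0" if "b < t" for t
  proof -
    have "{\<omega>\<in>\<Omega>. t \<le> x \<omega>} = {}" using hi that by force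
    then have "g t = v {}" by (simp only: g_def)
    then show ?thesis using v by (simp add: capacity_def)
  qed
  have "(LBINT t=-\<infinity>..0. g t - v \<Omega>) = (LBINT t=a..0. g t - v \<Omega>)"
    using \<open>a \<le> 0\<close> unfolding interval_lebesgue_integral_def set_lebesgue_integral_def zero_ereal_def
    by (auto intro!: Bochner_Integration.integral_cong simp: below split: split_indicator)
  also have "\<dots> = integral {a..0} (\<lambda>t. g t - v \<Omega>)"
    using interval_integral_eq_integral[OF \<open>a \<le> 0\<close> antimono_set_integrable[OF anti']]
    by (simp add: zero_ereal_def)
  also have "\<dots> = integral {a..0} g + a * v \<Omega>"
    using \<open>a \<le> 0\<close>
    by (subst Henstock_Kurzweil_Integration.integral_diff) (auto intro: int)
  finally have neg: "(LBINT t=-\<infinity>..0. g t - v \<Omega>) = integral {a..0} g + a * v \<Omega>" .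
  \<comment> \<open>The end point \<open>b\<close> is kept at first because \<open>g b\<close> may
    be nonzero; afterwards it is dropped as a null set.\<close>
  have "(LBINT t=0..\<infinity>. g t) = (LBINT t:{0<..b}. g t)"
    unfolding interval_lebesgue_integral_def set_lebesgue_integral_def zero_ereal_def
    by (auto intro!: Bochner_Integration.integral_cong simp: above split: split_indicator)
  also have "\<dots> = (LBINT t=0..b. g t)"
    using interval_integral_Ioc[of 0 b g] \<open>0 \<le> b\<close> by (simp add: zero_ereal_def)
  also have "\<dots> = integral {0..b} g"
    using interval_integral_eq_integral[OF \<open>0 \<le> b\<close> antimono_set_integrable[OF anti]]
    by (simp add: zero_ereal_def)
  finally have pos: "(LBINT t=0..\<infinity>. g t) = integral {0..b} g" .
  have "integral {a..0} g + integral {0..b} g = integral {a..b} g"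
    using Henstock_Kurzweil_Integration.integral_combine[OF \<open>a \<le> 0\<close> \<open>0 \<le> b\<close> int] .
  then show ?thesis using neg pos unfolding choquet_integral_def g_def by simp
qed

text \<open>Let \<open>g t\<close> be the capacity of the set where \<open>x\<close> is at least
  \<open>t\<close>. The call contributes the integral of \<open>g\<close> over
  \<open>[k, b]\<close>, the short put that over \<open>[a, k]\<close> plus
  \<open>(a - k) * v \<Omega>\<close>, and the constant \<open>k * v \<Omega>\<close>. The sum is
  the value at \<open>x\<close>.\<close>

lemma choquet_imp_put_call_parity:
  assumes "choquet_pricing_rule \<Omega> \<A> f"
  shows "put_call_parity \<Omega> \<A> f"
  unfolding put_call_parity_def
proof (intro ballI allI impI)
  fix x and k :: real assume x: "x \<in> bdd_meas \<Omega> \<A>" and "0 \<le> k"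
  obtain v where v: "capacity \<A> v"
    and f: "\<And>x. x \<in> bdd_meas \<Omega> \<A> \<Longrightarrow> f x = choquet_integral \<Omega> v x"
    using assms unfolding choquet_pricing_rule_def by blast
  obtain B where "B \<ge> 0" and B: "\<And>\<omega>. \<omega> \<in> \<Omega> \<Longrightarrow> - B \<le> x \<omega>" "\<And>\<omega>. \<omega> \<in> \<Omega> \<Longrightarrow> x \<omega> \<le> B"
    using bdd_meas_bounds[OF x] by blast
  \<comment> \<open>Adding \<open>k\<close> to the upper bound ensures \<open>k \<le> b\<close> also
    for strikes above the range of \<open>x\<close>, so that \<open>[a, b]\<close> can be cut at
    \<open>k\<close>.\<close>
  define a b where "a = - B" and "b = B + k"
  have ab: "a \<le> 0" "0 \<le> b" "a \<le> k" "k \<le> b"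
    using \<open>B \<ge> 0\<close> \<open>k \<ge> 0\<close> by (auto simp: a_def b_def)
  have lo: "a \<le> x \<omega>" and hi: "x \<omega> \<le> b" if "\<omega> \<in> \<Omega>" for \<omega>
    using B[OF that] \<open>k \<ge> 0\<close> by (auto simp: a_def b_def)
  define g where "g t = v {\<omega>\<in>\<Omega>. t \<le> x \<omega>}" for t
  have anti: "antimono g" unfolding g_def by (rule capacity_superlevel_antimono[OF v x])
  have int: "g integrable_on {s..t}" for s t
    using anti by (intro antimono_on_integrable) (auto simp: monotone_on_def)

  define c where "c = call_payoff \<Omega> x k"
  have c: "c \<in> bdd_meas \<Omega> \<A>"
    unfolding c_def call_payoff_def by (rule bdd_meas_compose[OF x]) (intro continuous_intros)
  have "f c = integral {0..b - k} (\<lambda>t. v {\<omega>\<in>\<Omega>. t \<le> c \<omega>})"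
    using choquet_integral_eq[OF v c, of 0 "b - k"] hi ab
    by (simp add: f[OF c]) (simp add: c_def call_payoff_def)
  also have "\<dots> = integral {0..b - k} (g \<circ> (+) k)"
  \<comment> \<open>At \<open>t = 0\<close> the superlevel set of the call is all of \<Omega>,
    whereas \<open>k \<le> x \<omega>\<close> may fail; this single level is negligible.\<close>
  proof (rule integral_spike[of "{0}"])
    fix t assume t: "t \<in> {0..b - k} - {0}"
    then have "{\<omega>\<in>\<Omega>. t \<le> c \<omega>} = {\<omega>\<in>\<Omega>. k + t \<le> x \<omega>}"
      by (auto simp: c_def call_payoff_def)
    then show "(g \<circ> (+) k) t = v {\<omega>\<in>\<Omega>. t \<le> c \<omega>}" by (simp add: g_def)
  qed simp
  also have "\<dots> = integral {k..b} g"
    by (subst integral_shift_Icc_real) simp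
  finally have fc: "f c = integral {k..b} g" .

  define p where "p = (\<lambda>\<omega>\<in>\<Omega>. - put_payoff \<Omega> x k \<omega>)"
  have p_eq: "p = (\<lambda>\<omega>\<in>\<Omega>. - max (k - x \<omega>) 0)"
    by (auto simp: p_def put_payoff_def)
  have p: "p \<in> bdd_meas \<Omega> \<A>"
    unfolding p_eq by (rule bdd_meas_compose[OF x]) (intro continuous_intros)
  have "f p = integral {a - k..0} (\<lambda>t. v {\<omega>\<in>\<Omega>. t \<le> p \<omega>}) + (a - k) * v \<Omega>"
    unfolding f[OF p]
  proof (rule choquet_integral_eq[OF v p])
    fix \<omega> assume "\<omega> \<in> \<Omega>"
    then show "a - k \<le> p \<omega>" "p \<omega> \<le> 0" using lo[of \<omega>] ab by (auto simp: p_eq)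
  qed (use ab in simp_all)
  also have "integral {a - k..0} (\<lambda>t. v {\<omega>\<in>\<Omega>. t \<le> p \<omega>}) = integral {a - k..0} (g \<circ> (+) k)"
  \<comment> \<open>For \<open>t \<le> 0\<close> the cut-off at 0 does not affect the comparison
    with \<open>t\<close>, so the sets agree at every level, end point included.\<close>
  proof (rule Henstock_Kurzweil_Integration.integral_cong)
    fix t assume "t \<in> {a - k..0}"
    then have "{\<omega>\<in>\<Omega>. t \<le> p \<omega>} = {\<omega>\<in>\<Omega>. k + t \<le> x \<omega>}"
      by (auto simp: p_eq)
    then show "v {\<omega>\<in>\<Omega>. t \<le> p \<omega>} = (g \<circ> (+) k) t" by (simp add: g_def)
  qed
  also have "\<dots> = integral {a..k} g"
    by (subst integral_shift_Icc_real) simp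
  finally have fp: "f p = integral {a..k} g + (a - k) * v \<Omega>" .

  have "f (\<lambda>\<omega>\<in>\<Omega>. k) = integral {0..k} (\<lambda>t. v {\<omega>\<in>\<Omega>. t \<le> (\<lambda>\<omega>\<in>\<Omega>. k) \<omega>})"
    using choquet_integral_eq[OF v bdd_meas_const, of 0 k k] \<open>k \<ge> 0\<close>
    by (simp add: f[OF bdd_meas_const])
  also have "\<dots> = integral {0..k} (\<lambda>_. v \<Omega>)"
  proof (rule Henstock_Kurzweil_Integration.integral_cong)
    fix t assume "t \<in> {0..k}"
    then have "{\<omega>\<in>\<Omega>. t \<le> (\<lambda>\<omega>\<in>\<Omega>. k) \<omega>} = \<Omega>" by auto
    then show "v {\<omega>\<in>\<Omega>. t \<le> (\<lambda>\<omega>\<in>\<Omega>. k) \<omega>} = v \<Omega>" by simp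
  qed
  finally have fk: "f (\<lambda>\<omega>\<in>\<Omega>. k) = k * v \<Omega>" using \<open>k \<ge> 0\<close> by simp

  have "f x = integral {a..b} g + a * v \<Omega>"
    using choquet_integral_eq[OF v x ab(1,2) lo hi] by (simp add: f[OF x] g_def[abs_def])
  moreover have "integral {a..k} g + integral {k..b} g = integral {a..b} g"
    using Henstock_Kurzweil_Integration.integral_combine[OF ab(3,4) int] .
  ultimately show "f x = f (call_payoff \<Omega> x k) + f (\<lambda>\<omega>\<in>\<Omega>. - put_payoff \<Omega> x k \<omega>) + f (\<lambda>\<omega>\<in>\<Omega>. k)"
    using fc fp fk unfolding c_def[symmetric] p_def[symmetric] by (simp add: algebra_simps)
qed

section \<open>Pricing rules satisfying parity\<close>

context
  fixes f :: "('a \<Rightarrow> real) \<Rightarrow> real"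
  assumes parity: "put_call_parity \<Omega> \<A> f" and mono: "monotone_rule \<Omega> \<A> f"
begin

section \<open>Consequences of parity: splitting, scaling, translation\<close>

lemma rule_mono:
  assumes "x \<in> bdd_meas \<Omega> \<A>" "y \<in> bdd_meas \<Omega> \<A>" "\<And>\<omega>. \<omega> \<in> \<Omega> \<Longrightarrow> x \<omega> \<le> y \<omega>"
  shows "f x \<le> f y"
  using mono assms unfolding monotone_rule_def by blast

text \<open>The short put is the cap of \<open>x\<close> at \<open>k\<close> lowered by
  \<open>k\<close>. In this form the last two terms can be recombined into the price of the
  cap.\<close>

lemma rule_parity:
  assumes "x \<in> bdd_meas \<Omega> \<A>" "k \<ge> 0"
  shows "f x = f (\<lambda>\<omega>\<in>\<Omega>. max (x \<omega> - k) 0) + f (\<lambda>\<omega>\<in>\<Omega>. min (x \<omega>) k - k) + f (\<lambda>\<omega>\<in>\<Omega>. k)"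
proof -
  have "(\<lambda>\<omega>\<in>\<Omega>. - put_payoff \<Omega> x k \<omega>) = (\<lambda>\<omega>\<in>\<Omega>. min (x \<omega>) k - k)"
    by (auto simp: put_payoff_def fun_eq_iff)
  then show ?thesis
    using parity assms unfolding put_call_parity_def call_payoff_def by simp
qed

text \<open>Parity for the zero claim at strike 0 makes its price three times itself.\<close>

lemma rule_zero: "f (\<lambda>\<omega>\<in>\<Omega>. 0) = 0"
  using rule_parity[OF bdd_meas_const[of 0], of 0] by (simp cong: restrict_cong)

text \<open>The call pays nothing here, so parity only detaches the constant
  \<open>k\<close>.\<close>

lemma rule_cap:
  assumes x: "x \<in> bdd_meas \<Omega> \<A>" and "k \<ge> 0" and le: "\<And>\<omega>. \<omega> \<in> \<Omega> \<Longrightarrow> x \<omega> \<le> k"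
  shows "f x = f (\<lambda>\<omega>\<in>\<Omega>. x \<omega> - k) + f (\<lambda>\<omega>\<in>\<Omega>. k)"
proof -
  have "(\<lambda>\<omega>\<in>\<Omega>. max (x \<omega> - k) 0) = (\<lambda>\<omega>\<in>\<Omega>. 0)" "(\<lambda>\<omega>\<in>\<Omega>. min (x \<omega>) k - k) = (\<lambda>\<omega>\<in>\<Omega>. x \<omega> - k)"
    using le by (auto simp: fun_eq_iff max_def min_def)
  then show ?thesis using rule_parity[OF x \<open>k \<ge> 0\<close>] by (simp add: rule_zero)
qed

text \<open>Applied to the cap itself, \<open>rule_cap\<close> merges the put and the constant of
  parity into the price of the cap.\<close>

lemma rule_split:
  assumes x: "x \<in> bdd_meas \<Omega> \<A>" and "k \<ge> 0"
  shows "f x = f (\<lambda>\<omega>\<in>\<Omega>. max (x \<omega> - k) 0) + f (\<lambda>\<omega>\<in>\<Omega>. min (x \<omega>) k)"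
proof -
  have "(\<lambda>\<omega>\<in>\<Omega>. min (x \<omega>) k) \<in> bdd_meas \<Omega> \<A>"
    by (rule bdd_meas_compose[OF x]) (intro continuous_intros)
  from rule_cap[OF this \<open>k \<ge> 0\<close>]
  have "f (\<lambda>\<omega>\<in>\<Omega>. min (x \<omega>) k) = f (\<lambda>\<omega>\<in>\<Omega>. min (x \<omega>) k - k) + f (\<lambda>\<omega>\<in>\<Omega>. k)"
    by (simp cong: restrict_cong)
  then show ?thesis using rule_parity[OF x \<open>k \<ge> 0\<close>] by simp
qed

text \<open>Splitting \<open>a + b\<close> units of the indicator at level \<open>a\<close> leaves
  \<open>b\<close> units as excess and \<open>a\<close> units as cap. The price is thus additive and
  monotone in the number of units, hence linear.\<close>

lemma rule_scaled_indicator: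
  assumes A: "A \<in> \<A>" and "c \<ge> 0"
  shows "f (\<lambda>\<omega>\<in>\<Omega>. c * indicat_real A \<omega>) = c * f (restrict (indicat_real A) \<Omega>)"
proof -
  let ?h = "\<lambda>c. f (\<lambda>\<omega>\<in>\<Omega>. c * indicat_real A \<omega>)"
  have "?h c = c * ?h 1"
  proof (rule mono_additive_linear[OF _ _ \<open>c \<ge> 0\<close>])
    fix a b :: real assume ab: "a \<ge> 0" "b \<ge> 0"
    have "(\<lambda>\<omega>\<in>\<Omega>. max ((\<lambda>\<omega>\<in>\<Omega>. (a + b) * indicat_real A \<omega>) \<omega> - a) 0) = (\<lambda>\<omega>\<in>\<Omega>. b * indicat_real A \<omega>)"
      and "(\<lambda>\<omega>\<in>\<Omega>. min ((\<lambda>\<omega>\<in>\<Omega>. (a + b) * indicat_real A \<omega>) \<omega>) a) = (\<lambda>\<omega>\<in>\<Omega>. a * indicat_real A \<omega>)"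
      using ab by (auto simp: fun_eq_iff indicator_def)
    then show "?h (a + b) = ?h a + ?h b"
      using rule_split[OF bdd_meas_indicator[OF A, of "a + b"] ab(1)] by simp
  next
    fix a b :: real assume "a \<le> b"
    then show "?h a \<le> ?h b"
      by (intro rule_mono bdd_meas_indicator A) (auto intro: mult_right_mono)
  qed
  then show ?thesis by simp
qed

lemma rule_const:
  assumes "k \<ge> 0"
  shows "f (\<lambda>\<omega>\<in>\<Omega>. k) = k * f (restrict (indicat_real \<Omega>) \<Omega>)"
proof -
  have "(\<lambda>\<omega>\<in>\<Omega>. k * indicat_real \<Omega> \<omega>) = (\<lambda>\<omega>\<in>\<Omega>. k)" by (rule restrict_ext) simp
  then show ?thesis using rule_scaled_indicator[OF carrier_in_sigma_algebra assms] by simp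
qed

text \<open>Both \<open>x\<close> and \<open>x + k\<close> are compared with \<open>x - M\<close>, where \<open>M \<ge> 0\<close> is an upper bound of \<open>x\<close>.\<close>

lemma rule_translate:
  assumes x: "x \<in> bdd_meas \<Omega> \<A>" and "k \<ge> 0"
  shows "f (\<lambda>\<omega>\<in>\<Omega>. x \<omega> + k) = f x + k * f (restrict (indicat_real \<Omega>) \<Omega>)"
proof -
  obtain M where M: "M \<ge> 0" "\<And>\<omega>. \<omega> \<in> \<Omega> \<Longrightarrow> - M \<le> x \<omega>" "\<And>\<omega>. \<omega> \<in> \<Omega> \<Longrightarrow> x \<omega> \<le> M"
    using bdd_meas_bounds[OF x] by blast
  have "f x = f (\<lambda>\<omega>\<in>\<Omega>. x \<omega> - M) + f (\<lambda>\<omega>\<in>\<Omega>. M)"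
    by (rule rule_cap[OF x M(1,3)])
  moreover have xk: "(\<lambda>\<omega>\<in>\<Omega>. x \<omega> + k) \<in> bdd_meas \<Omega> \<A>"
    by (rule bdd_meas_compose[OF x]) (intro continuous_intros)
  have "f (\<lambda>\<omega>\<in>\<Omega>. x \<omega> + k) = f (\<lambda>\<omega>\<in>\<Omega>. x \<omega> - M) + f (\<lambda>\<omega>\<in>\<Omega>. M + k)"
    using rule_cap[OF xk, of "M + k"] M(1,3) \<open>k \<ge> 0\<close> by (simp cong: restrict_cong)
  ultimately show ?thesis
    using rule_const[of M] rule_const[of "M + k"] M(1) \<open>k \<ge> 0\<close> by (simp add: algebra_simps)
qed

section \<open>Representation by a Choquet integral\<close>

lemma rule_nonneg_eq_integral:
  assumes y: "y \<in> bdd_meas \<Omega> \<A>" and "b \<ge> 0"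
    and lo: "\<And>\<omega>. \<omega> \<in> \<Omega> \<Longrightarrow> 0 \<le> y \<omega>" and hi: "\<And>\<omega>. \<omega> \<in> \<Omega> \<Longrightarrow> y \<omega> \<le> b"
  shows "f y = integral {0..b} (\<lambda>t. f (restrict (indicat_real {\<omega>\<in>\<Omega>. t \<le> y \<omega>}) \<Omega>))"
proof -
  let ?A = "\<lambda>t. {\<omega>\<in>\<Omega>. t \<le> y \<omega>}"
  define F where "F t = f (\<lambda>\<omega>\<in>\<Omega>. min (y \<omega>) t)" for t
  have cap: "(\<lambda>\<omega>\<in>\<Omega>. min (y \<omega>) t) \<in> bdd_meas \<Omega> \<A>" for t
    by (rule bdd_meas_compose[OF y]) (intro continuous_intros)
  have slice: "(\<lambda>\<omega>\<in>\<Omega>. max (min (y \<omega>) t - s) 0) \<in> bdd_meas \<Omega> \<A>" for s t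
    by (rule bdd_meas_compose[OF y]) (intro continuous_intros)
  \<comment> \<open>The cap at \<open>t\<close> is itself split at level \<open>s\<close>; as
    \<open>s \<le> t\<close>, capping it again gives the cap of \<open>y\<close> at
    \<open>s\<close>, and the excess is the slice.\<close>
  have F_diff: "F t - F s = f (\<lambda>\<omega>\<in>\<Omega>. max (min (y \<omega>) t - s) 0)" if "0 \<le> s" "s \<le> t" for s t
  proof -
    have "(\<lambda>\<omega>\<in>\<Omega>. min ((\<lambda>\<omega>\<in>\<Omega>. min (y \<omega>) t) \<omega>) s) = (\<lambda>\<omega>\<in>\<Omega>. min (y \<omega>) s)"
      using that by (auto simp: fun_eq_iff)
    moreover have "(\<lambda>\<omega>\<in>\<Omega>. max ((\<lambda>\<omega>\<in>\<Omega>. min (y \<omega>) t) \<omega> - s) 0) = (\<lambda>\<omega>\<in>\<Omega>. max (min (y \<omega>) t - s) 0)"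
      by (auto simp: fun_eq_iff)
    ultimately show ?thesis
      using rule_split[OF cap[of t] that(1)] by (simp add: F_def)
  qed
  have "integral {0..b} (\<lambda>t. f (restrict (indicat_real (?A t)) \<Omega>)) = F b - F 0"
  proof (rule integral_eq_if_sandwich[OF \<open>b \<ge> 0\<close>])
    fix s t :: real assume st: "0 \<le> s" "s \<le> t" "t \<le> b"
    have "f (\<lambda>\<omega>\<in>\<Omega>. (t - s) * indicat_real (?A t) \<omega>) \<le> F t - F s"
      unfolding F_diff[OF st(1,2)]
      by (intro rule_mono bdd_meas_indicator bdd_meas_superlevel[OF y] slice)
         (use st in \<open>auto simp: indicator_def\<close>)
    then show "(t - s) * f (restrict (indicat_real (?A t)) \<Omega>) \<le> F t - F s"
      using rule_scaled_indicator[OF bdd_meas_superlevel[OF y]] st by simp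
    have "F t - F s \<le> f (\<lambda>\<omega>\<in>\<Omega>. (t - s) * indicat_real (?A s) \<omega>)"
      unfolding F_diff[OF st(1,2)]
      by (intro rule_mono bdd_meas_indicator bdd_meas_superlevel[OF y] slice)
         (use st in \<open>auto simp: indicator_def\<close>)
    then show "F t - F s \<le> (t - s) * f (restrict (indicat_real (?A s)) \<Omega>)"
      using rule_scaled_indicator[OF bdd_meas_superlevel[OF y]] st by simp
  qed
  moreover have "F 0 = 0"
    using lo rule_zero unfolding F_def by (simp cong: restrict_cong)
  moreover have "F b = f y"
  proof -
    \<comment> \<open>Off \<Omega> both sides are \<open>undefined\<close> because \<open>y\<close>
      is extensional, so \<open>f\<close> receives literally the same argument.\<close>
    have "(\<lambda>\<omega>\<in>\<Omega>. min (y \<omega>) b) = y"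
      using y hi by (auto simp: bdd_meas_def extensional_def fun_eq_iff min_def)
    then show ?thesis by (simp add: F_def)
  qed
  ultimately show ?thesis by simp
qed

text \<open>The integral formula covers nonnegative claims, so \<open>x\<close> is first raised by a
  bound \<open>B\<close>. This adds \<open>B * v \<Omega>\<close> to the price by
  \<open>rule_translate\<close>, and the same term appears when the integral over
  \<open>[- B, B]\<close> is rewritten as a Choquet integral, so the two cancel.\<close>

lemma put_call_parity_imp_choquet: "choquet_pricing_rule \<Omega> \<A> f"
  unfolding choquet_pricing_rule_def
proof (intro exI conjI ballI)
  \<comment> \<open>The choice is forced: the Choquet integral of the indicator of \<open>A\<close>
    is \<open>v A\<close>.\<close>
  define v where "v A = f (restrict (indicat_real A) \<Omega>)" for A
  have ind: "restrict (indicat_real A) \<Omega> \<in> bdd_meas \<Omega> \<A>" if "A \<in> \<A>" for A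
    using bdd_meas_indicator[OF that, of 1] by simp
  show cap: "capacity \<A> v"
    unfolding capacity_def
  proof (intro conjI ballI impI)
    have "restrict (indicat_real {}) \<Omega> = (\<lambda>\<omega>\<in>\<Omega>. 0)" by (auto simp: fun_eq_iff)
    then show "v {} = 0" using rule_zero by (simp add: v_def)
    fix A B assume "A \<in> \<A>" "B \<in> \<A>" "A \<subseteq> B"
    then show "v A \<le> v B"
      unfolding v_def by (intro rule_mono ind) (auto simp: indicator_def)
  qed
  fix x assume x: "x \<in> bdd_meas \<Omega> \<A>"
  obtain B where B: "B \<ge> 0" "\<And>\<omega>. \<omega> \<in> \<Omega> \<Longrightarrow> - B \<le> x \<omega>" "\<And>\<omega>. \<omega> \<in> \<Omega> \<Longrightarrow> x \<omega> \<le> B"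
    using bdd_meas_bounds[OF x] by blast
  define y where "y = (\<lambda>\<omega>\<in>\<Omega>. x \<omega> + B)"
  have y: "y \<in> bdd_meas \<Omega> \<A>"
    unfolding y_def by (rule bdd_meas_compose[OF x]) (intro continuous_intros)
  have "f y = integral {0..2 * B} (\<lambda>t. v {\<omega>\<in>\<Omega>. t \<le> y \<omega>})"
    unfolding v_def
  proof (rule rule_nonneg_eq_integral[OF y])
    fix \<omega> assume "\<omega> \<in> \<Omega>"
    then show "0 \<le> y \<omega>" "y \<omega> \<le> 2 * B" using B(2,3)[of \<omega>] by (auto simp: y_def)
  qed (use B in simp)
  \<comment> \<open>Level \<open>t\<close> of \<open>y\<close> is level \<open>t - B\<close> of
    \<open>x\<close>, which carries \<open>[0, 2 * B]\<close> to \<open>[- B, B]\<close>.\<close>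
  also have "\<dots> = integral {0..2 * B} ((\<lambda>t. v {\<omega>\<in>\<Omega>. t \<le> x \<omega>}) \<circ> (+) (- B))"
  proof (rule Henstock_Kurzweil_Integration.integral_cong)
    fix t
    have "{\<omega>\<in>\<Omega>. t \<le> y \<omega>} = {\<omega>\<in>\<Omega>. - B + t \<le> x \<omega>}" by (auto simp: y_def)
    then show "v {\<omega>\<in>\<Omega>. t \<le> y \<omega>} = ((\<lambda>t. v {\<omega>\<in>\<Omega>. t \<le> x \<omega>}) \<circ> (+) (- B)) t" by simp
  qed
  also have "\<dots> = integral {- B..B} (\<lambda>t. v {\<omega>\<in>\<Omega>. t \<le> x \<omega>})"
    by (subst integral_shift_Icc_real) simp
  also have "\<dots> = choquet_integral \<Omega> v x + B * v \<Omega>"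
    using choquet_integral_eq[OF cap x, of "- B" B] B by simp
  finally show "f x = choquet_integral \<Omega> v x"
    using rule_translate[OF x B(1)] by (simp add: y_def v_def)
qed

end

end

theorem theorem1:
  fixes \<Omega> :: "'a set" and \<A> :: "'a set set" and f :: "('a \<Rightarrow> real) \<Rightarrow> real"
  assumes "sigma_algebra \<Omega> \<A>"
    and "pricing_rule \<Omega> \<A> f"
    and "monotone_rule \<Omega> \<A> f"
  shows "put_call_parity \<Omega> \<A> f \<longleftrightarrow> choquet_pricing_rule \<Omega> \<A> f"
  using put_call_parity_imp_choquet[OF assms(1) _ assms(3)] choquet_imp_put_call_parity[OF assms(1)]
  by blast

end
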